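(* Let $m\ge 1$. The generating function $\sum_{n\ge 0}\big(\sum_{\pi\in NC_n}q^{\mu_{\tau}(\pi)}\big)x^n$ counting members of $NC_n$ for $n\ge 0$ according to the number of occurrences of the subword $\tau$ is given, for $\tau=1^m$, by $$\frac{1-qx+(q-1)x^m-\sqrt{(1-qx+(q-1)x^m)\big((1-4x)(1-qx)-3(q-1)x^m\big)}}{2x(1-qx+(q-1)x^{m-1})},$$ and, for $\tau=1^m2$, by $$\frac{1+(q-1)x^m-\sqrt{(1-(q-1)x^m)^2-4x}}{2x(1+(q-1)x^{m-1})}.$$
   Context: A set partition of $[n]=\{1,\dots,n\}$ with blocks $B_1,\dots,B_k$ ordered so that $\min B_1<\cdots<\min B_k$ is represented by its canonical sequential form $\pi=\pi_1\cdots\pi_n$, where $i\in B_{\pi_i}$ for each $i$. It is non-crossing if $\pi$ contains no (not necessarily consecutive) subsequence of the form $a\,b\,a\,b$ with $a<b$. $NC_n$ denotes the set of non-crossing partitions of $[n]$, identified with their canonical sequential forms ($NC_0$ consists of the empty partition). A subword pattern is a finite sequence $\tau=\tau_1\cdots\tau_k$ of positive integers whose set of distinct letters is $[\ell]$ for some $\ell$. An occurrence of $\tau$ in a sequence $\rho_1\cdots\rho_n$ is an index $i\in[n-k+1]$ such that the string of consecutive letters $\rho_i\cdots\rho_{i+k-1}$ is order-isomorphic to $\tau$ (same relative order, including equalities). $\mu_\tau(\pi)$ denotes the number of occurrences of $\tau$ in $\pi$. $1^m$ is the word of $m$ ones, and $1^m2$ is $m$ ones followed by a $2$. The formulas are identities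 of formal power series in $x$ (over $\mathbb{Q}(q)$), the square roots being those with constant term $1$. *)

theory Defs
  imports
    "HOL-Library.Disjoint_Sets"
    "HOL-Computational_Algebra.Computational_Algebra"
begin

text \<open>The position of \<^term>\<open>B\<close> among the blocks of \<^term>\<open>P\<close>, counted from 1 and ordered by minima.\<close>

definition block_index :: "nat set set \<Rightarrow> nat set \<Rightarrow> nat" where
  "block_index P B = card {C \<in> P. Min C \<le> Min B}"

definition canonical_form :: "nat \<Rightarrow> nat set set \<Rightarrow> nat list" where
  "canonical_form n P = map (\<lambda>i. block_index P (THE B. B \<in> P \<and> i \<in> B)) [1..<Suc n]"

definition noncrossing_word :: "nat list \<Rightarrow> bool" where
  "noncrossing_word w \<longleftrightarrow>
     \<not> (\<exists>i j k l. i < j \<and> j < k \<and> k < l \<and> l < length w \<and>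
          w ! i = w ! k \<and> w ! j = w ! l \<and> w ! i < w ! j)"

definition NC :: "nat \<Rightarrow> nat set set set" where
  "NC n = {P. partition_on {1..n} P \<and> noncrossing_word (canonical_form n P)}"

definition order_isomorphic :: "nat list \<Rightarrow> nat list \<Rightarrow> bool" where
  "order_isomorphic u v \<longleftrightarrow> length u = length v \<and>
     (\<forall>i < length u. \<forall>j < length u.
        (u ! i < u ! j \<longleftrightarrow> v ! i < v ! j) \<and> (u ! i = u ! j \<longleftrightarrow> v ! i = v ! j))"

definition occurrences :: "nat list \<Rightarrow> nat list \<Rightarrow> nat" where
  "occurrences \<tau> \<rho> =
     card {i. i + length \<tau> \<le> length \<rho> \<and> order_isomorphic (take (length \<tau>) (drop i \<rho>)) \<tau>}"

definition q_var :: "rat poly fract" where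
  "q_var = to_fract [:0, 1:]"

definition NC_gf :: "nat list \<Rightarrow> rat poly fract fps" where
  "NC_gf \<tau> = Abs_fps (\<lambda>n. \<Sum>P\<in>NC n. q_var ^ occurrences \<tau> (canonical_form n P))"

text \<open>The first argument of \<^const>\<open>fps_radical\<close> chooses the root of the constant term.
  The result is meaningful only for series with constant term 1.\<close>

definition fps_sqrt :: "'a::field_char_0 fps \<Rightarrow> 'a fps" where
  "fps_sqrt f = fps_radical (\<lambda>_ _. 1) 2 f"

lemma fps_sqrt_unique:
  assumes "fps_nth f 0 = 1"
  shows "s = fps_sqrt f \<longleftrightarrow> s ^ 2 = f \<and> fps_nth s 0 = 1"
proof -
  have "s ^ Suc 1 = f \<longleftrightarrow> s = fps_radical (\<lambda>_ _. 1) (Suc 1) f" if "fps_nth s 0 = 1"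
    by (rule radical_unique) (use assms that in auto)
  moreover have "fps_nth (fps_sqrt f) 0 = 1"
    by (simp add: fps_sqrt_def)
  ultimately show ?thesis
    by (auto simp: fps_sqrt_def numeral_2_eq_2)
qed

end

theory Submission
  imports Defs
begin

text \<open>
  Read a non-crossing canonical form from left to right. A letter \<open>b\<close> is closed once some \<open>a < b\<close>
  has reappeared after it, since a further \<open>b\<close> would complete \<open>a b a b\<close>. The next letter is therefore
  either new or open, and choosing it closes exactly the larger open letters. Recording the number of
  open letters after each step gives a bijection onto the words \<open>h\<close> over the positive integers with
  \<open>h\<^sub>1 = 1\<close> and \<open>h\<^bsub>i+1\<^esub> \<le> h\<^sub>i + 1\<close>. It preserves the comparison of adjacent letters, so for a
  weakly increasing pattern it preserves occurrences.

  A nonempty height word is \<open>1\<^sup>j\<close>, or uniquely \<open>1\<^sup>j \<alpha>\<^sup>+ \<beta>\<close> with \<open>\<alpha>\<close> nonempty, where \<open>\<alpha>\<close> and \<open>\<beta>\<close>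
  are height words and \<open>\<alpha>\<^sup>+\<close> is \<open>\<alpha>\<close> with all letters raised by one. No occurrence straddles the descent
  between \<open>\<alpha>\<^sup>+\<close> and \<open>\<beta>\<close>, so \<open>F = 1 + K\<^sub>0 + K\<^sub>1 (F - 1) F\<close> with explicit rational series \<open>K\<^sub>0\<close>, \<open>K\<^sub>1\<close>
  for the runs of ones. Clearing denominators leaves a quadratic equation for \<open>F\<close>.
\<close>

section \<open>Ranks in finite sets\<close>

text \<open>Ranks occur twice in the development: a block index is the rank of a block by its
  minimum, and a height is the rank of a letter among the letters that could stand in its place.
  Strictness comes from \<open>y\<close>, which is counted in its own rank but not in that of an
  \<open>x\<close> with smaller value.\<close>

lemma rank_less_iff:
  fixes f :: "'a \<Rightarrow> nat"
  assumes "finite S" "x \<in> S" "y \<in> S"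
  shows "card {z\<in>S. f z \<le> f x} < card {z\<in>S. f z \<le> f y} \<longleftrightarrow> f x < f y"
proof -
  have less: "card {z\<in>S. f z \<le> f x} < card {z\<in>S. f z \<le> f y}" if "f x < f y" "y \<in> S" for x y
  proof (rule psubset_card_mono)
    show "{z\<in>S. f z \<le> f x} \<subset> {z\<in>S. f z \<le> f y}" using that by force
  qed (use assms in auto)
  have le: "card {z\<in>S. f z \<le> f x} \<le> card {z\<in>S. f z \<le> f y}" if "f x \<le> f y" for x y
    by (rule card_mono) (use assms that in auto)
  show ?thesis using less le assms by (meson leD not_less)
qed

lemma rank_eq_iff:
  fixes f :: "'a \<Rightarrow> nat"
  assumes "finite S" "x \<in> S" "y \<in> S"
  shows "card {z\<in>S. f z \<le> f x} = card {z\<in>S. f z \<le> f y} \<longleftrightarrow> f x = f y"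
  using rank_less_iff[OF assms, of f] rank_less_iff[OF assms(1,3,2), of f]
  by (cases "f x" "f y" rule: linorder_cases) simp_all

lemma bij_betw_rank:
  fixes f :: "'a \<Rightarrow> nat"
  assumes "finite S" "inj_on f S"
  shows "bij_betw (\<lambda>x. card {z\<in>S. f z \<le> f x}) S {1..card S}"
proof -
  let ?r = "\<lambda>x. card {z\<in>S. f z \<le> f x}"
  have inj: "inj_on ?r S"
  proof (rule inj_onI)
    fix x y assume xy: "x \<in> S" "y \<in> S" "?r x = ?r y"
    then have "f x = f y" using rank_eq_iff[OF assms(1), of x y f] by simp
    then show "x = y" using assms(2) xy by (auto dest: inj_onD)
  qed
  have "?r x \<in> {1..card S}" if "x \<in> S" for x
  proof -
    have "{z\<in>S. f z \<le> f x} \<noteq> {}" using that by auto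
    then have "?r x > 0" using assms by (simp add: card_gt_0_iff)
    moreover have "?r x \<le> card S" by (rule card_mono) (use assms in auto)
    ultimately show ?thesis by auto
  qed
  then have "?r ` S \<subseteq> {1..card S}" by auto
  moreover have "card (?r ` S) = card {1..card S}" using inj by (simp add: card_image)
  ultimately have "?r ` S = {1..card S}" by (intro card_subset_eq) auto
  with inj show ?thesis by (simp add: bij_betw_def)
qed

section \<open>Canonical forms as restricted growth words\<close>

text \<open>The restricted growth condition. The usual form, that a letter exceeds the maximum of
  its predecessors by at most one, would need a convention for the empty prefix.\<close>

definition rg_word :: "nat list \<Rightarrow> bool" where
  "rg_word w \<longleftrightarrow> (\<forall>i<length w. 1 \<le> w ! i \<and> (\<forall>c. 1 \<le> c \<and> c < w ! i \<longrightarrow> (\<exists>j<i. w ! j = c)))"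

text \<open>List positions start at 0 and elements of the ground set at 1, hence
  \<open>Suc i\<close>. Disjointness of the blocks resolves the definite description.\<close>

lemma canonical_form_nth:
  assumes P: "partition_on {1..n} P" and B: "B \<in> P" "Suc i \<in> B"
  shows "i < n" "canonical_form n P ! i = block_index P B"
proof -
  have "Suc i \<in> {1..n}" unfolding partition_onD1[OF P] using B by blast
  then show i: "i < n" by simp
  have "(THE B. B \<in> P \<and> Suc i \<in> B) = B"
    using B partition_onD2[OF P] by (intro the_equality) (auto simp: disjoint_def)
  then show "canonical_form n P ! i = block_index P B"
    using i by (simp add: canonical_form_def del: upt_Suc)
qed

lemma length_canonical_form [simp]: "length (canonical_form n P) = n"
  by (simp add: canonical_form_def del: upt_Suc)

section \<open>From partitions to restricted growth words\<close>

context
  fixes n :: nat and P :: "nat set set"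
  assumes P: "partition_on {1..n} P"
begin

lemma partition_finite: "finite P"
  using P by (rule finite_elements[rotated]) simp

lemma block_Min:
  assumes "B \<in> P"
  shows "finite B" "Min B \<in> B"
proof -
  have "B \<subseteq> {1..n}" using assms partition_onD1[OF P] by auto
  then show f: "finite B" by (rule finite_subset) simp
  show "Min B \<in> B" using f assms partition_onD3[OF P] by (intro Min_in) auto
qed

lemma obtain_pred:
  assumes "B \<in> P" "k \<in> B"
  obtains i where "k = Suc i"
proof -
  have "k \<in> {1..n}" unfolding partition_onD1[OF P] using assms by blast
  then show ?thesis using that by (cases k) auto
qed

lemma inj_on_Min_blocks: "inj_on Min P"
proof (rule inj_onI)
  fix B C assume "B \<in> P" "C \<in> P" "Min B = Min C"
  then show "B = C" using block_Min[of B] block_Min[of C] partition_onD2[OF P]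
    by (auto simp: disjoint_def)
qed

lemma bij_betw_block_index: "bij_betw (block_index P) P {1..card P}"
  using bij_betw_rank[OF partition_finite inj_on_Min_blocks] by (simp add: block_index_def [abs_def])

lemma obtain_block:
  assumes "i < n"
  obtains B where "B \<in> P" "Suc i \<in> B"
proof -
  have "Suc i \<in> \<Union>P" using assms partition_onD1[OF P, symmetric] by simp
  then show ?thesis using that by blast
qed

text \<open>A block \<open>C\<close> of smaller index than the block \<open>B\<close> of the current
  element has a smaller minimum. This minimum precedes the current element, and the index of
  \<open>C\<close> is written there.\<close>

lemma rg_word_canonical_form: "rg_word (canonical_form n P)"
  unfolding rg_word_def
proof (intro allI impI conjI)
  fix i assume "i < length (canonical_form n P)"
  then obtain B where B: "B \<in> P" "Suc i \<in> B" using obtain_block by auto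
  note ci = canonical_form_nth(2)[OF P B]
  have bi: "block_index P B \<in> {1..card P}" using bij_betw_block_index B by (auto simp: bij_betw_def)
  show "1 \<le> canonical_form n P ! i" using bi ci by simp
  fix c assume c: "1 \<le> c \<and> c < canonical_form n P ! i"
  then have "c \<in> {1..card P}" using bi ci by auto
  then obtain C where C: "C \<in> P" "block_index P C = c"
    unfolding bij_betw_imp_surj_on[OF bij_betw_block_index, symmetric] by blast
  have "Min C < Min B"
    using rank_less_iff[OF partition_finite, of C B Min] C B c ci by (simp add: block_index_def)
  also have "Min B \<le> Suc i" using block_Min[OF B(1)] B by simp
  finally have "Min C < Suc i" .
  moreover obtain j where "Min C = Suc j" using obtain_pred[OF C(1) block_Min(2)[OF C(1)]] by blast
  ultimately have j: "Min C = Suc j" "j < i" by auto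
  have "Suc j \<in> C" using block_Min[OF C(1)] j by simp
  then have "canonical_form n P ! j = c" using canonical_form_nth(2)[OF P C(1)] C by simp
  then show "\<exists>j<i. canonical_form n P ! j = c" using j by auto
qed

end

text \<open>The block that the letter \<open>c\<close> stands for; \<open>Suc\<close> converts list
  positions to elements of the ground set.\<close>

definition fibre :: "nat list \<Rightarrow> nat \<Rightarrow> nat set" where
  "fibre w c = {Suc i | i. i < length w \<and> w ! i = c}"

lemma fibre_canonical_form:
  assumes P: "partition_on {1..n} P" and B: "B \<in> P"
  shows "fibre (canonical_form n P) (block_index P B) = B"
proof (intro equalityI subsetI)
  fix k assume "k \<in> fibre (canonical_form n P) (block_index P B)"
  then obtain i where i: "k = Suc i" "i < n" "canonical_form n P ! i = block_index P B"
    by (auto simp: fibre_def)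
  obtain C where C: "C \<in> P" "Suc i \<in> C" using obtain_block[OF P i(2)] by blast
  then have "block_index P C = block_index P B" using canonical_form_nth[OF P C] i by simp
  then have "C = B" using bij_betw_block_index[OF P] C B by (auto simp: bij_betw_def inj_on_def)
  then show "k \<in> B" using C i by simp
next
  fix k assume k: "k \<in> B"
  then obtain i where i: "k = Suc i" using obtain_pred[OF P B] by blast
  then show "k \<in> fibre (canonical_form n P) (block_index P B)"
    using canonical_form_nth[OF P B, of i] k by (auto simp: fibre_def)
qed

lemma fibres_canonical_form:
  assumes P: "partition_on {1..n} P"
  shows "fibre (canonical_form n P) ` set (canonical_form n P) = P"
proof -
  have "set (canonical_form n P) = block_index P ` P"
  proof (intro equalityI subsetI)
    fix c assume "c \<in> set (canonical_form n P)"
    then obtain i where i: "i < n" "c = canonical_form n P ! i" by (auto simp: in_set_conv_nth)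
    obtain B where B: "B \<in> P" "Suc i \<in> B" using obtain_block[OF P i(1)] by blast
    then show "c \<in> block_index P ` P" using canonical_form_nth[OF P B] i by simp
  next
    fix c assume "c \<in> block_index P ` P"
    then obtain B where B: "B \<in> P" "c = block_index P B" by blast
    have M: "Min B \<in> B" using block_Min[OF P B(1)] by simp
    then obtain i where "Min B = Suc i" using obtain_pred[OF P B(1)] by blast
    then show "c \<in> set (canonical_form n P)"
      using canonical_form_nth[OF P B(1), of i] M B by (auto simp: in_set_conv_nth)
  qed
  then show ?thesis using fibre_canonical_form[OF P] by (simp add: image_image)
qed

section \<open>From restricted growth words back to partitions\<close>

context
  fixes w :: "nat list"
  assumes w: "rg_word w"
begin

lemma rg_word_set:
  assumes "d \<in> set w"
  shows "{1..d} \<subseteq> set w" "0 < d"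
proof -
  obtain i where i: "i < length w" "w ! i = d" using assms by (auto simp: in_set_conv_nth)
  show "0 < d" using i w unfolding rg_word_def by (metis gr0I not_one_le_zero)
  show "{1..d} \<subseteq> set w"
  proof
    fix c assume c: "c \<in> {1..d}"
    show "c \<in> set w"
    proof (cases "c = d")
      case False
      then have "1 \<le> c \<and> c < w ! i" using c i by auto
      then obtain j where "j < i" "w ! j = c" using w i unfolding rg_word_def by blast
      then show ?thesis using i by auto
    qed (use assms in simp)
  qed
qed

lemma finite_fibre: "finite (fibre w c)"
  by (rule finite_subset[of _ "{..length w}"]) (auto simp: fibre_def)

lemma fibre_nonempty: "c \<in> set w \<Longrightarrow> fibre w c \<noteq> {}"
  by (auto simp: fibre_def in_set_conv_nth)

text \<open>Restricted growth puts some \<open>c\<close> before the first \<open>d\<close>. Thus the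
  order of the letters agrees with the order of the blocks by minima.\<close>

lemma Min_fibre_less:
  assumes "1 \<le> c" "c < d" "d \<in> set w"
  shows "Min (fibre w c) < Min (fibre w d)"
proof -
  have "Min (fibre w d) \<in> fibre w d" using assms by (intro Min_in finite_fibre fibre_nonempty)
  then obtain i where i: "Min (fibre w d) = Suc i" "i < length w" "w ! i = d" by (auto simp: fibre_def)
  then obtain j where j: "j < i" "w ! j = c" using w assms unfolding rg_word_def by blast
  have "Min (fibre w c) \<le> Suc j" using i j by (intro Min_le finite_fibre) (auto simp: fibre_def)
  then show ?thesis using i j by simp
qed

lemma partition_on_fibres: "partition_on {1..length w} (fibre w ` set w)"
proof (rule partition_onI)
  show "\<Union>(fibre w ` set w) = {1..length w}"
  proof (intro equalityI subsetI)
    fix k assume "k \<in> {1..length w}"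
    then obtain i where "k = Suc i" "i < length w" by (cases k) auto
    then show "k \<in> \<Union>(fibre w ` set w)" by (auto simp: fibre_def)
  qed (auto simp: fibre_def)
qed (use fibre_nonempty in \<open>auto simp: fibre_def disjnt_def\<close>)

text \<open>The blocks whose minimum is at most that of the fibre of \<open>d\<close> are exactly
  the fibres of \<open>1, ..., d\<close>, and these are distinct.\<close>

lemma block_index_fibre:
  assumes d: "d \<in> set w"
  shows "block_index (fibre w ` set w) (fibre w d) = d"
proof -
  have "{C \<in> fibre w ` set w. Min C \<le> Min (fibre w d)} = fibre w ` {1..d}"
  proof (intro equalityI subsetI)
    fix C assume "C \<in> {C \<in> fibre w ` set w. Min C \<le> Min (fibre w d)}"
    then obtain c where c: "c \<in> set w" "C = fibre w c" "Min (fibre w c) \<le> Min (fibre w d)" by blast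
    have "\<not> d < c" using Min_fibre_less[of d c] rg_word_set(2)[OF d] c by auto
    then show "C \<in> fibre w ` {1..d}" using c rg_word_set(2)[of c] by auto
  next
    fix C assume "C \<in> fibre w ` {1..d}"
    then obtain c where c: "C = fibre w c" "1 \<le> c" "c \<le> d" by auto
    then show "C \<in> {C \<in> fibre w ` set w. Min C \<le> Min (fibre w d)}"
      using Min_fibre_less[of c d] d rg_word_set(1)[OF d] by (cases "c = d") auto
  qed
  moreover have "inj_on (fibre w) {1..d}"
  proof (rule linorder_inj_onI)
    fix a b assume ab: "a < b" "a \<in> {1..d}" "b \<in> {1..d}"
    then have "b \<in> set w" using rg_word_set(1)[OF d] by blast
    then show "fibre w a \<noteq> fibre w b" using Min_fibre_less[of a b] ab by auto
  qed auto
  ultimately show ?thesis by (simp add: block_index_def card_image)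
qed

lemma canonical_form_fibres: "canonical_form (length w) (fibre w ` set w) = w"
proof (rule nth_equalityI)
  fix i assume "i < length (canonical_form (length w) (fibre w ` set w))"
  then have *: "w ! i \<in> set w" "Suc i \<in> fibre w (w ! i)" by (auto simp: fibre_def)
  then show "canonical_form (length w) (fibre w ` set w) ! i = w ! i"
    using canonical_form_nth(2)[OF partition_on_fibres imageI[OF *(1)] *(2)] block_index_fibre[OF *(1)] by simp
qed simp

end

definition NC_words :: "nat \<Rightarrow> nat list set" where
  "NC_words n = {w. length w = n \<and> rg_word w \<and> noncrossing_word w}"

lemma bij_betw_canonical_form: "bij_betw (canonical_form n) (NC n) (NC_words n)"
proof (rule bij_betwI[where g = "\<lambda>w. fibre w ` set w"])
  show "canonical_form n \<in> NC n \<rightarrow> NC_words n"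
    by (auto simp: NC_def NC_words_def rg_word_canonical_form)
  show "(\<lambda>w. fibre w ` set w) \<in> NC_words n \<rightarrow> NC n"
    by (auto simp: NC_def NC_words_def canonical_form_fibres simp del: One_nat_def intro: partition_on_fibres)
qed (auto simp: NC_def NC_words_def fibres_canonical_form canonical_form_fibres)

section \<open>Height words\<close>

abbreviation height_step :: "nat \<Rightarrow> nat \<Rightarrow> bool" where
  "height_step a b \<equiv> 0 < b \<and> b \<le> Suc a"

text \<open>The 0 put in front forces the first letter to be 1, because a step from 0 can only lead
  to 1, and it lets the empty word be treated like any other prefix.\<close>

definition height_words :: "nat list set" where
  "height_words = {w. successively height_step (0 # w)}"

text \<open>The word already contains \<open>a x a\<close> with \<open>a < x\<close>, so that
  appending \<open>x\<close> would complete a crossing.\<close>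

definition blocked :: "nat list \<Rightarrow> nat \<Rightarrow> bool" where
  "blocked w x \<longleftrightarrow> (\<exists>i j k. i < j \<and> j < k \<and> k < length w \<and> w ! i = w ! k \<and> w ! j = x \<and> w ! i < x)"

definition open_letters :: "nat list \<Rightarrow> nat set" where
  "open_letters w = {x \<in> set w. \<not> blocked w x}"

definition height_word :: "nat list \<Rightarrow> nat list" where
  "height_word w = map (\<lambda>i. card (open_letters (take (Suc i) w))) [0..<length w]"

section \<open>Appending one letter\<close>

lemma rg_word_snoc: "rg_word (w @ [x]) \<longleftrightarrow> rg_word w \<and> 1 \<le> x \<and> {1..<x} \<subseteq> set w"
proof -
  have "(\<forall>c. 1 \<le> c \<and> c < x \<longrightarrow> (\<exists>j<length w. w ! j = c)) \<longleftrightarrow> {1..<x} \<subseteq> set w"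
    by (auto simp: in_set_conv_nth subset_iff)
  moreover have "(\<exists>j<i. (w @ [x]) ! j = c) \<longleftrightarrow> (\<exists>j<i. w ! j = c)" if "i \<le> length w" for i c
    using that by (intro ex_cong1 conj_cong refl) (simp add: nth_append)
  moreover have "(\<forall>i<length (w @ [x]). Q i) \<longleftrightarrow> (\<forall>i<length w. Q i) \<and> Q (length w)" for Q
    by (auto simp: less_Suc_eq)
  ultimately show ?thesis unfolding rg_word_def
    by (simp add: nth_append del: One_nat_def)
qed

lemma noncrossing_word_snoc:
  "noncrossing_word (w @ [x]) \<longleftrightarrow> noncrossing_word w \<and> \<not> blocked w x" (is "?L \<longleftrightarrow> ?R")
proof
  assume L: ?L
  have "noncrossing_word w" unfolding noncrossing_word_def
  proof safe
    fix i j k l assume "i < j" "j < k" "k < l" "l < length w" "w ! i = w ! k" "w ! j = w ! l" "w ! i < w ! j"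
    then show False using L[unfolded noncrossing_word_def, simplified, rule_format, of i j k l]
      by (simp add: nth_append)
  qed
  moreover have "\<not> blocked w x" unfolding blocked_def
  proof safe
    fix i j k assume "i < j" "j < k" "k < length w" "w ! i = w ! k" "x = w ! j" "w ! i < w ! j"
    then show False using L[unfolded noncrossing_word_def, simplified, rule_format, of i j k "length w"]
      by (simp add: nth_append)
  qed
  ultimately show ?R by blast
next
  assume R: ?R
  show ?L unfolding noncrossing_word_def
  proof safe
    fix i j k l assume *: "i < j" "j < k" "k < l" "l < length (w @ [x])" "(w @ [x]) ! i = (w @ [x]) ! k"
      "(w @ [x]) ! j = (w @ [x]) ! l" "(w @ [x]) ! i < (w @ [x]) ! j"
    show False
    proof (cases "l < length w")
      case True
      then have "w ! i = w ! k" "w ! j = w ! l" "w ! i < w ! j" using * by (simp_all add: nth_append)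
      then show False using R * True unfolding noncrossing_word_def by blast
    next
      case False
      then have "k < length w" using * by simp
      then have "w ! i = w ! k" "w ! j = x" "w ! i < x" using * False by (simp_all add: nth_append)
      then show False using R * \<open>k < length w\<close> unfolding blocked_def by blast
    qed
  qed
qed

text \<open>A new \<open>y\<close> can act only as the second \<open>a\<close> of a blocking triple
  \<open>a x a\<close>. The first one comes for free: by restricted growth, a smaller letter
  \<open>y\<close> occurs before any occurrence of \<open>x\<close>.\<close>

lemma blocked_snoc:
  assumes "rg_word (w @ [y])"
  shows "blocked (w @ [y]) x \<longleftrightarrow> blocked w x \<or> y < x \<and> x \<in> set w" (is "?L \<longleftrightarrow> ?R")
proof
  assume ?L
  then obtain i j k where *: "i < j" "j < k" "k < Suc (length w)" "(w @ [y]) ! i = (w @ [y]) ! k"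
      "(w @ [y]) ! j = x" "(w @ [y]) ! i < x" unfolding blocked_def by auto
  show ?R
  proof (cases "k < length w")
    case True
    then have "w ! i = w ! k" "w ! j = x" "w ! i < x" using * by (simp_all add: nth_append)
    then show ?R using * True unfolding blocked_def by blast
  next
    case False
    then have "k = length w" using * by simp
    with * show ?R by (auto simp: nth_append)
  qed
next
  assume ?R
  then show ?L
  proof
    assume "blocked w x"
    then obtain i j k where "i < j" "j < k" "k < length w" "w ! i = w ! k" "w ! j = x" "w ! i < x"
      unfolding blocked_def by blast
    then show ?L unfolding blocked_def
      by (intro exI[of _ i] exI[of _ j] exI[of _ k]) (simp add: nth_append)
  next
    assume x: "y < x \<and> x \<in> set w"
    then obtain j where j: "j < length w" "w ! j = x" by (auto simp: in_set_conv_nth)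
    have "1 \<le> y" "rg_word w" using assms by (auto simp: rg_word_snoc)
    then obtain i where "i < j" "w ! i = y" using x j unfolding rg_word_def by blast
    then show ?L unfolding blocked_def using j x
      by (intro exI[of _ i] exI[of _ j] exI[of _ "length w"]) (simp add: nth_append)
  qed
qed

lemma open_letters_snoc:
  assumes "rg_word (w @ [y])" "\<not> blocked w y"
  shows "open_letters (w @ [y]) = insert y {x \<in> open_letters w. x \<le> y}"
  using assms(2) by (auto simp: open_letters_def blocked_snoc[OF assms(1)])

lemma finite_open_letters [simp]: "finite (open_letters w)"
  by (simp add: open_letters_def)

text \<open>The candidates for the next letter. The letters of a restricted growth word form an
  initial segment, so the only possible new letter is their number plus one.\<close>

definition extensions :: "nat list \<Rightarrow> nat set" where
  "extensions w = insert (Suc (card (set w))) (open_letters w)"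

lemma rg_word_set_eq:
  assumes "rg_word w"
  shows "set w = {1..card (set w)}"
  using assms
proof (induction w rule: rev_induct)
  case (snoc x w)
  then have "rg_word w" "1 \<le> x" "{1..<x} \<subseteq> set w" by (auto simp: rg_word_snoc)
  with snoc.IH have IH: "set w = {1..card (set w)}" by blast
  define M where "M = card (set w)"
  have IH: "set w = {1..M}" using IH by (simp add: M_def)
  have "x \<le> Suc M"
  proof (rule ccontr)
    assume "\<not> x \<le> Suc M"
    then have "Suc M \<in> {1..<x}" by simp
    with \<open>{1..<x} \<subseteq> set w\<close> have "Suc M \<in> {1..M}" unfolding IH by blast
    then show False by simp
  qed
  then have "set (w @ [x]) = {1..M} \<or> set (w @ [x]) = {1..Suc M}"
    using \<open>1 \<le> x\<close> by (auto simp: IH)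
  then show ?case by (metis card_atLeastAtMost diff_Suc_1)
qed simp

text \<open>Restricted growth admits the old letters and \<open>Suc M\<close>; non-crossing removes
  the blocked ones. The letter \<open>Suc M\<close> is not blocked because it does not yet
  occur.\<close>

lemma extensions_iff:
  assumes "rg_word w" "noncrossing_word w"
  shows "x \<in> extensions w \<longleftrightarrow> rg_word (w @ [x]) \<and> noncrossing_word (w @ [x])"
proof -
  define M where "M = card (set w)"
  have M: "set w = {1..M}" using rg_word_set_eq[OF assms(1)] by (simp add: M_def)
  have "1 \<le> x \<and> {1..<x} \<subseteq> set w \<longleftrightarrow> x = Suc M \<or> x \<in> set w"
  proof -
    have "x \<le> Suc M" if "{1..<x} \<subseteq> {1..M}"
    proof (rule ccontr)
      assume "\<not> x \<le> Suc M"
      then have "Suc M \<in> {1..<x}" by simp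
      with that have "Suc M \<in> {1..M}" by blast
      then show False by simp
    qed
    then show ?thesis unfolding M by (cases "x = Suc M") auto
  qed
  moreover have "\<not> blocked w (Suc M)"
  proof
    assume "blocked w (Suc M)"
    then have "Suc M \<in> set w" unfolding blocked_def by (metis less_trans nth_mem)
    then show False by (simp add: M)
  qed
  ultimately show ?thesis using assms
    by (auto simp: extensions_def M_def[symmetric] rg_word_snoc noncrossing_word_snoc open_letters_def)
qed

lemma open_letters_less:
  assumes "rg_word w" "x \<in> open_letters w"
  shows "x < Suc (card (set w))"
proof -
  have "x \<in> {1..card (set w)}"
    using assms rg_word_set_eq[OF assms(1)] unfolding open_letters_def by blast
  then show ?thesis by simp
qed

text \<open>Choosing \<open>x\<close> closes the larger open letters and keeps the rest, so the new
  height is the rank of \<open>x\<close> in \<open>extensions w\<close>. This turns statements about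
  heights into statements about ranks.\<close>

lemma open_letters_extension:
  assumes "rg_word w" "noncrossing_word w" "x \<in> extensions w"
  shows "open_letters (w @ [x]) = {y \<in> extensions w. y \<le> x}"
proof -
  have "rg_word (w @ [x])" "\<not> blocked w x"
    using assms extensions_iff by (auto simp: noncrossing_word_snoc)
  then show ?thesis using assms open_letters_less[OF assms(1)]
    by (fastforce simp: open_letters_snoc extensions_def)
qed

text \<open>The current height is likewise the rank of the last letter in
  \<open>extensions w\<close>, the set that also ranks the next letter. Adjacent heights thereby
  become ranks in one common set.\<close>

lemma open_letters_last:
  assumes "rg_word w" "noncrossing_word w" "w \<noteq> []"
  shows "last w \<in> open_letters w" "open_letters w = {y \<in> extensions w. y \<le> last w}"
proof -
  obtain v y where v: "w = v @ [y]" using assms(3) by (metis append_butlast_last_id)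
  have *: "rg_word v" "noncrossing_word v" using assms by (auto simp: v rg_word_snoc noncrossing_word_snoc)
  then have y: "y \<in> extensions v" using assms by (simp add: extensions_iff v)
  then show l: "last w \<in> open_letters w" by (simp add: v open_letters_extension[OF * y])
  show "open_letters w = {y \<in> extensions w. y \<le> last w}"
    using open_letters_less[OF assms(1) l] open_letters_extension[OF * y]
    by (auto simp: extensions_def v)
qed

lemma height_word_snoc: "height_word (w @ [x]) = height_word w @ [card (open_letters (w @ [x]))]"
  by (simp add: height_word_def)

lemma length_height_word [simp]: "length (height_word w) = length w"
  by (simp add: height_word_def)

lemma last_height_word: "last (0 # height_word w) = card (open_letters w)"
  by (cases w rule: rev_cases) (simp_all add: height_word_snoc, simp add: height_word_def open_letters_def)

lemma height_words_snoc: "w @ [x] \<in> height_words \<longleftrightarrow> w \<in> height_words \<and> height_step (last (0 # w)) x"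
  using successively_append_iff[of height_step "0 # w" "[x]"] by (simp add: height_words_def)

section \<open>The bijection between non-crossing words and height words\<close>

lemma NC_words_Suc: "NC_words (Suc n) = {w @ [x] | w x. w \<in> NC_words n \<and> x \<in> extensions w}"
proof (intro equalityI subsetI)
  fix v assume v: "v \<in> NC_words (Suc n)"
  then obtain w x where "v = w @ [x]" by (cases v rule: rev_cases) (auto simp: NC_words_def)
  with v show "v \<in> {w @ [x] | w x. w \<in> NC_words n \<and> x \<in> extensions w}"
    by (auto simp: NC_words_def extensions_iff rg_word_snoc noncrossing_word_snoc)
qed (auto simp: NC_words_def extensions_iff)

text \<open>With \<open>k\<close> open letters there are \<open>k + 1\<close> extensions, whose
  ranks run through \<open>1, ..., k + 1\<close>. These are exactly the heights that
  \<open>height_step\<close> allows after \<open>k\<close>.\<close>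

lemma bij_betw_card_open_letters:
  assumes "w \<in> NC_words n"
  shows "bij_betw (\<lambda>x. card (open_letters (w @ [x]))) (extensions w) {1..Suc (card (open_letters w))}"
proof -
  have w: "rg_word w" "noncrossing_word w" using assms by (auto simp: NC_words_def)
  have "Suc (card (set w)) \<notin> open_letters w" using open_letters_less[OF w(1)] by blast
  then have "card (extensions w) = Suc (card (open_letters w))" by (simp add: extensions_def)
  moreover have "finite (extensions w)" by (simp add: extensions_def)
  ultimately have "bij_betw (\<lambda>x. card {y \<in> extensions w. y \<le> x}) (extensions w) {1..Suc (card (open_letters w))}"
    using bij_betw_rank[of "extensions w" id] by simp
  then show ?thesis
    by (rule bij_betw_cong[THEN iffD1, rotated]) (simp add: open_letters_extension[OF w])
qed

text \<open>Induction on the length: the prefix is determined by the induction hypothesis, and the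
  last letter by its rank among the extensions of that prefix.\<close>

lemma bij_betw_height_word: "bij_betw height_word (NC_words n) {h \<in> height_words. length h = n}"
proof (induction n)
  case 0
  have "NC_words 0 = {[]}" by (auto simp: NC_words_def rg_word_def noncrossing_word_def)
  moreover have "{h \<in> height_words. length h = 0} = {[]}" by (auto simp: height_words_def)
  ultimately show ?case by (simp add: height_word_def)
next
  case (Suc n)
  show ?case unfolding bij_betw_def
  proof (intro conjI inj_onI)
    fix v v' assume "v \<in> NC_words (Suc n)" "v' \<in> NC_words (Suc n)" and eq: "height_word v = height_word v'"
    then obtain w x w' x' where w: "v = w @ [x]" "w \<in> NC_words n" "x \<in> extensions w"
        "v' = w' @ [x']" "w' \<in> NC_words n" "x' \<in> extensions w'" by (auto simp: NC_words_Suc)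
    with eq Suc have "w' = w" by (auto simp: height_word_snoc bij_betw_def inj_on_def)
    then show "v = v'" using w eq bij_betw_card_open_letters[OF w(2)]
      by (auto simp: height_word_snoc bij_betw_def inj_on_def)
  next
    show "height_word ` NC_words (Suc n) = {h \<in> height_words. length h = Suc n}"
    proof (intro equalityI subsetI)
      fix h assume "h \<in> height_word ` NC_words (Suc n)"
      then obtain w x where w: "h = height_word (w @ [x])" "w \<in> NC_words n" "x \<in> extensions w"
        by (auto simp: NC_words_Suc)
      have "height_word w \<in> height_words \<and> length w = n" using Suc w by (auto simp: bij_betw_def NC_words_def)
      moreover have "card (open_letters (w @ [x])) \<in> {1..Suc (card (open_letters w))}"
        using bij_betw_card_open_letters[OF w(2)] w by (auto simp: bij_betw_def)
      ultimately show "h \<in> {h \<in> height_words. length h = Suc n}"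
        unfolding w height_word_snoc by (simp add: height_words_snoc last_height_word del: last.simps)
    next
      fix g assume g: "g \<in> {h \<in> height_words. length h = Suc n}"
      then obtain h a where h: "g = h @ [a]" "length h = n"
        by (cases g rule: rev_cases) auto
      with g have "h \<in> height_words" and a: "height_step (last (0 # h)) a" by (auto simp: height_words_snoc)
      with h Suc obtain w where w: "w \<in> NC_words n" "h = height_word w" by (auto simp: bij_betw_def)
      have "a \<in> {1..Suc (card (open_letters w))}" using a by (simp add: w last_height_word del: last.simps)
      then obtain x where "x \<in> extensions w" "a = card (open_letters (w @ [x]))"
        using bij_betw_card_open_letters[OF w(1)] by (force simp: bij_betw_def)
      then have "g = height_word (w @ [x])" "w @ [x] \<in> NC_words (Suc n)"
        using w h by (auto simp: height_word_snoc NC_words_Suc)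
      then show "g \<in> height_word ` NC_words (Suc n)" by blast
    qed
  qed
qed

lemma height_word_less_iff:
  assumes "rg_word w" "noncrossing_word w" "Suc i < length w"
  shows "height_word w ! i < height_word w ! Suc i \<longleftrightarrow> w ! i < w ! Suc i"
    and "height_word w ! i = height_word w ! Suc i \<longleftrightarrow> w ! i = w ! Suc i"
proof -
  define v x where "v = take (Suc i) w" and "x = w ! Suc i"
  have vx: "v @ [x] = take (Suc (Suc i)) w"
    using assms(3) by (simp add: v_def x_def take_Suc_conv_app_nth)
  \<comment> \<open>Induction on the number of removed letters, since the properties of a word pass
    to the word without its last letter.\<close>
  have nc: "rg_word (take k w) \<and> noncrossing_word (take k w)" if "k \<le> length w" for k
    using that
  proof (induction "length w - k" arbitrary: k)
    case (Suc d)
    then have "rg_word (take (Suc k) w) \<and> noncrossing_word (take (Suc k) w)" by auto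
    with Suc show ?case by (simp add: take_Suc_conv_app_nth rg_word_snoc noncrossing_word_snoc)
  qed (use assms in simp)
  have v: "rg_word v" "noncrossing_word v" "v \<noteq> []" using assms(3) nc[of "Suc i"] by (auto simp: v_def)
  have x: "x \<in> extensions v" using extensions_iff[OF v(1,2), of x] nc[of "Suc (Suc i)"] assms(3) vx by simp
  have lv: "last v = w ! i" using assms(3) by (simp add: v_def take_Suc_conv_app_nth)
  have y: "last v \<in> extensions v" using open_letters_last(1)[OF v] by (simp add: extensions_def)
  have h1: "height_word w ! Suc i = card (open_letters (v @ [x]))"
    using assms(3) by (simp add: height_word_def vx)
  have h0: "height_word w ! i = card (open_letters v)" using assms(3) by (simp add: height_word_def v_def)
  have fin: "finite (extensions v)" by (simp add: extensions_def)
  have *: "height_word w ! i = card {y \<in> extensions v. id y \<le> id (last v)}"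
     "height_word w ! Suc i = card {y \<in> extensions v. id y \<le> id x}"
    unfolding h0 h1 open_letters_last(2)[OF v] open_letters_extension[OF v(1,2) x] by simp_all
  show "height_word w ! i < height_word w ! Suc i \<longleftrightarrow> w ! i < w ! Suc i"
    unfolding * using rank_less_iff[OF fin y x, of id] lv x_def by simp
  show "height_word w ! i = height_word w ! Suc i \<longleftrightarrow> w ! i = w ! Suc i"
    unfolding * using rank_eq_iff[OF fin y x, of id] lv x_def by simp
qed

section \<open>Occurrences of weakly increasing patterns\<close>

text \<open>Only neighbouring letters are compared, because these comparisons are what the passage
  to height words preserves.\<close>

definition adjacent_match :: "nat list \<Rightarrow> nat list \<Rightarrow> nat \<Rightarrow> bool" where
  "adjacent_match \<tau> w i \<longleftrightarrow> (\<forall>p. Suc p < length \<tau> \<longrightarrow>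
     (w ! (i + p) < w ! Suc (i + p) \<longleftrightarrow> \<tau> ! p < \<tau> ! Suc p) \<and>
     (w ! (i + p) = w ! Suc (i + p) \<longleftrightarrow> \<tau> ! p = \<tau> ! Suc p))"

text \<open>In a weakly increasing word two letters differ exactly if some step between them is
  strict, so the comparisons of neighbours determine all the others.\<close>

lemma order_isomorphic_sorted:
  assumes "sorted \<tau>" "i + length \<tau> \<le> length w"
  shows "order_isomorphic (take (length \<tau>) (drop i w)) \<tau> \<longleftrightarrow> adjacent_match \<tau> w i"
proof
  assume iso: "order_isomorphic (take (length \<tau>) (drop i w)) \<tau>"
  show "adjacent_match \<tau> w i" unfolding adjacent_match_def
  proof (intro allI impI)
    fix p assume p: "Suc p < length \<tau>"
    then show "(w ! (i + p) < w ! Suc (i + p) \<longleftrightarrow> \<tau> ! p < \<tau> ! Suc p) \<and>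
        (w ! (i + p) = w ! Suc (i + p) \<longleftrightarrow> \<tau> ! p = \<tau> ! Suc p)"
      using iso[unfolded order_isomorphic_def, THEN conjunct2, rule_format, of p "Suc p"] assms(2) by simp
  qed
next
  assume adj: "adjacent_match \<tau> w i"
  define u where "u = take (length \<tau>) (drop i w)"
  have len: "length u = length \<tau>" using assms(2) by (simp add: u_def)
  have step: "(u ! p < u ! Suc p \<longleftrightarrow> \<tau> ! p < \<tau> ! Suc p) \<and> (u ! p = u ! Suc p \<longleftrightarrow> \<tau> ! p = \<tau> ! Suc p)"
    if "Suc p < length \<tau>" for p
    using adj assms(2) that by (simp add: adjacent_match_def u_def)
  have mono: "u ! a \<le> u ! b \<and> (u ! a < u ! b \<longleftrightarrow> \<tau> ! a < \<tau> ! b)" if "a \<le> b" "b < length \<tau>" for a b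
    using that
  proof (induction b rule: dec_induct)
    case (step b)
    have "\<tau> ! b \<le> \<tau> ! Suc b" "\<tau> ! a \<le> \<tau> ! b"
      using assms(1) step by (auto intro: sorted_nth_mono)
    \<comment> \<open>The fact quoted by its shape is the comparison of neighbours from above, whose
      name the induction case hides.\<close>
    then show ?case using step \<open>\<And>p. Suc p < length \<tau> \<Longrightarrow> _ p\<close>[of b] by force
  qed simp
  show "order_isomorphic (take (length \<tau>) (drop i w)) \<tau>"
    unfolding order_isomorphic_def u_def[symmetric] len
  proof (intro conjI allI impI refl)
    fix a b assume ab: "a < length \<tau>" "b < length \<tau>"
    have "\<tau> ! min a b \<le> \<tau> ! max a b" using assms(1) ab by (intro sorted_nth_mono) auto
    then show "u ! a < u ! b \<longleftrightarrow> \<tau> ! a < \<tau> ! b" "u ! a = u ! b \<longleftrightarrow> \<tau> ! a = \<tau> ! b"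
      using mono[of a b] mono[of b a] ab by (cases "a \<le> b"; force)+
  qed
qed

lemma occurrences_sorted:
  assumes "sorted \<tau>"
  shows "occurrences \<tau> w = card {i. i + length \<tau> \<le> length w \<and> adjacent_match \<tau> w i}"
  unfolding occurrences_def using order_isomorphic_sorted[OF assms] by (intro arg_cong[of _ _ card]) auto

lemma occurrences_cong:
  assumes "sorted \<tau>" "length v = length w"
    and "\<And>i. Suc i < length w \<Longrightarrow> v ! i < v ! Suc i \<longleftrightarrow> w ! i < w ! Suc i"
    and "\<And>i. Suc i < length w \<Longrightarrow> v ! i = v ! Suc i \<longleftrightarrow> w ! i = w ! Suc i"
  shows "occurrences \<tau> v = occurrences \<tau> w"
proof -
  have "adjacent_match \<tau> v i \<longleftrightarrow> adjacent_match \<tau> w i" if "i + length \<tau> \<le> length w" for i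
    using that assms(3,4) unfolding adjacent_match_def by (intro all_cong imp_cong refl) simp
  then show ?thesis unfolding occurrences_sorted[OF assms(1)] assms(2)
    by (intro arg_cong[of _ _ card]) auto
qed

lemma occurrences_map_Suc:
  assumes "sorted \<tau>"
  shows "occurrences \<tau> (map Suc w) = occurrences \<tau> w"
  by (rule occurrences_cong[OF assms]) auto

lemma occurrences_height_word:
  assumes "sorted \<tau>" "w \<in> NC_words n"
  shows "occurrences \<tau> (height_word w) = occurrences \<tau> w"
  using assms(2) by (intro occurrences_cong[OF assms(1)])
    (auto simp: NC_words_def height_word_less_iff)

lemma finite_occurrences: "finite {i. i + k \<le> (l::nat) \<and> Q i}"
  by (rule finite_subset[of _ "{..l}"]) auto

text \<open>A window lies in \<open>u\<close>, lies in \<open>v\<close>, or straddles the junction;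
  the last summand counts the straddling occurrences, which are then determined separately for each
  kind of junction.\<close>

lemma occurrences_append:
  assumes "sorted \<tau>" "\<tau> \<noteq> []"
  shows "occurrences \<tau> (u @ v) = occurrences \<tau> u + occurrences \<tau> v +
    card {i. i < length u \<and> length u < i + length \<tau> \<and> i + length \<tau> \<le> length u + length v \<and> adjacent_match \<tau> (u @ v) i}"
    (is "_ = _ + _ + card ?S")
proof -
  let ?k = "length \<tau>"
  let ?U = "{i. i + ?k \<le> length u \<and> adjacent_match \<tau> u i}"
  let ?V = "{i. i + ?k \<le> length v \<and> adjacent_match \<tau> v i}"
  have k: "0 < ?k" using assms by simp
  have U: "adjacent_match \<tau> (u @ v) i \<longleftrightarrow> adjacent_match \<tau> u i" if "i + ?k \<le> length u" for i
    using that unfolding adjacent_match_def by (intro all_cong imp_cong refl) (simp add: nth_append)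
  have V: "adjacent_match \<tau> (u @ v) (length u + i) \<longleftrightarrow> adjacent_match \<tau> v i" for i
    unfolding adjacent_match_def by (intro all_cong imp_cong refl) (simp add: nth_append add.assoc)
  have "{i. i + ?k \<le> length (u @ v) \<and> adjacent_match \<tau> (u @ v) i} = (?U \<union> (+) (length u) ` ?V) \<union> ?S"
  proof (intro equalityI subsetI)
    fix i assume i: "i \<in> {i. i + ?k \<le> length (u @ v) \<and> adjacent_match \<tau> (u @ v) i}"
    consider "i + ?k \<le> length u" | "length u \<le> i" | "i < length u" "length u < i + ?k" by linarith
    then show "i \<in> (?U \<union> (+) (length u) ` ?V) \<union> ?S"
    proof cases
      case 2
      then obtain j where "i = length u + j" using le_Suc_ex by blast
      with i V[of j] show ?thesis by auto
    qed (use i U in auto)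
  qed (use U V in auto)
  moreover have "card ((?U \<union> (+) (length u) ` ?V) \<union> ?S) = card (?U \<union> (+) (length u) ` ?V) + card ?S"
    by (rule card_Un_disjoint) (use k in \<open>auto simp: finite_occurrences\<close>)
  moreover have "card (?U \<union> (+) (length u) ` ?V) = card ?U + card ((+) (length u) ` ?V)"
    by (rule card_Un_disjoint) (use k in \<open>auto simp: finite_occurrences\<close>)
  moreover have "card ((+) (length u) ` ?V) = card ?V" by (rule card_image) simp
  ultimately show ?thesis unfolding occurrences_sorted[OF assms(1)] by simp
qed

text \<open>A straddling window would contain the descent from \<open>last u\<close> to
  \<open>hd v\<close>, which a weakly increasing pattern cannot match.\<close>

lemma occurrences_append_descent:
  assumes "sorted \<tau>" "\<tau> \<noteq> []" "u \<noteq> []" "v = [] \<or> hd v < last u"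
  shows "occurrences \<tau> (u @ v) = occurrences \<tau> u + occurrences \<tau> v"
proof -
  have "\<not> adjacent_match \<tau> (u @ v) i"
    if i: "i < length u" "length u < i + length \<tau>" "i + length \<tau> \<le> length u + length v" for i
  proof
    assume adj: "adjacent_match \<tau> (u @ v) i"
    \<comment> \<open>The place in the window that falls on the last letter of
      \<open>u\<close>.\<close>
    define p where "p = length u - Suc i"
    have p: "i + p = length u - 1" "Suc (i + p) = length u" "Suc p < length \<tau>" using i by (auto simp: p_def)
    have v: "v \<noteq> []" using i by auto
    have "\<tau> ! p \<le> \<tau> ! Suc p" using p assms(1) by (intro sorted_nth_mono) auto
    then have "(u @ v) ! (i + p) \<le> (u @ v) ! Suc (i + p)"
      using adj p(3) unfolding adjacent_match_def by (metis le_less)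
    then have "last u \<le> hd v"
      unfolding p(2) using assms(3) v by (simp add: p(1) nth_append last_conv_nth hd_conv_nth)
    then show False using assms(4) v by simp
  qed
  then show ?thesis unfolding occurrences_append[OF assms(1,2)] by auto
qed

section \<open>The patterns \<open>1^m\<close> and \<open>1^m2\<close> on runs of equal
  letters\<close>

lemma sorted_patterns: "sorted (replicate m (1::nat))" "sorted (replicate m (1::nat) @ [2])"
  by (auto simp: sorted_append)

lemma adjacent_match_level:
  "adjacent_match (replicate m 1) w i \<longleftrightarrow> (\<forall>p. Suc p < m \<longrightarrow> w ! (i + p) = w ! Suc (i + p))"
  by (auto simp: adjacent_match_def)

lemma adjacent_match_level_ascent:
  assumes "m \<ge> 1"
  shows "adjacent_match (replicate m 1 @ [2]) w i \<longleftrightarrow>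
    (\<forall>p. Suc p < m \<longrightarrow> w ! (i + p) = w ! Suc (i + p)) \<and> w ! (i + m - 1) < w ! (i + m)"
proof -
  have "(\<forall>p. Suc p < Suc m \<longrightarrow> Q p) \<longleftrightarrow> (\<forall>p. Suc p < m \<longrightarrow> Q p) \<and> Q (m - 1)" for Q
    using assms by (metis Suc_diff_1 Suc_le_eq Suc_less_eq less_Suc_eq_le less_antisym less_imp_le_nat One_nat_def lessI)
  then show ?thesis using assms by (auto simp: adjacent_match_def nth_append)
qed

text \<open>The windows start at \<open>0, ..., j - m\<close>; truncated subtraction gives 0 for
  runs shorter than \<open>m\<close>.\<close>

lemma occurrences_level_replicate:
  assumes "m \<ge> 1"
  shows "occurrences (replicate m 1) (replicate j c) = Suc j - m"
proof -
  have "{i. i + m \<le> j \<and> adjacent_match (replicate m 1) (replicate j c) i} = {..<Suc j - m}"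
    by (auto simp: adjacent_match_level simp del: One_nat_def)
  then show ?thesis by (simp add: occurrences_sorted sorted_patterns)
qed

lemma occurrences_level_append_ascent:
  assumes "m \<ge> 1" "u \<noteq> []" "v \<noteq> []" "last u < hd v"
  shows "occurrences (replicate m 1) (u @ v) = occurrences (replicate m 1) u + occurrences (replicate m 1) v"
proof -
  have "\<not> adjacent_match (replicate m 1) (u @ v) i"
    if i: "i < length u" "length u < i + m" for i
  proof
    assume adj: "adjacent_match (replicate m 1) (u @ v) i"
    define p where "p = length u - Suc i"
    have p: "i + p = length u - 1" "Suc (i + p) = length u" "Suc p < m" using i by (auto simp: p_def)
    have "(u @ v) ! (i + p) = (u @ v) ! Suc (i + p)"
      using adj p(3) unfolding adjacent_match_level by blast
    then have "last u = hd v"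
      unfolding p(2) using assms by (simp add: p(1) nth_append last_conv_nth hd_conv_nth)
    then show False using assms(4) by simp
  qed
  then have "{i. i < length u \<and> length u < i + m \<and> i + m \<le> length u + length v \<and> adjacent_match (replicate m 1) (u @ v) i} = {}"
    by blast
  then show ?thesis using assms(1) by (simp add: occurrences_append sorted_patterns)
qed

lemma occurrences_level_ascent_replicate:
  assumes "m \<ge> 1"
  shows "occurrences (replicate m 1 @ [2]) (replicate j c) = 0"
proof -
  have "{i. i + Suc m \<le> j \<and> adjacent_match (replicate m 1 @ [2]) (replicate j c) i} = {}"
    using assms by (auto simp: adjacent_match_level_ascent simp del: One_nat_def)
  moreover have "length (replicate m (1::nat) @ [2]) = Suc m" by simp
  ultimately show ?thesis
    unfolding occurrences_sorted[OF sorted_patterns(2)] length_replicate by (simp only: card.empty)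
qed

text \<open>The pattern is level up to its final ascent, so a straddling occurrence must have this
  ascent at the junction. There is exactly one if the run has at least \<open>m\<close> letters, and
  none otherwise.\<close>

lemma occurrences_level_ascent_run:
  assumes "m \<ge> 1" "j \<ge> 1" "v \<noteq> []" "c < hd v"
  shows "occurrences (replicate m 1 @ [2]) (replicate j c @ v) =
    of_bool (m \<le> j) + occurrences (replicate m 1 @ [2]) v"
proof -
  let ?w = "replicate j c @ v"
  have "{i. i < j \<and> j < i + Suc m \<and> i + Suc m \<le> j + length v \<and> adjacent_match (replicate m 1 @ [2]) ?w i}
     = (if m \<le> j then {j - m} else {})"
  proof -
    have "i + m = j" if "i < j" "j < i + Suc m" "adjacent_match (replicate m 1 @ [2]) ?w i" for i
    proof (rule ccontr)
      assume "i + m \<noteq> j"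
      define p where "p = j - Suc i"
      have p: "i + p = j - 1" "Suc (i + p) = j" "Suc p < m" using that \<open>i + m \<noteq> j\<close> by (auto simp: p_def)
      have "?w ! (i + p) = ?w ! Suc (i + p)"
        using that(3) p(3) assms(1) unfolding adjacent_match_level_ascent[OF assms(1)] by blast
      then have "c = hd v" unfolding p(2) using assms(2,3) by (simp add: p(1) nth_append hd_conv_nth)
      then show False using assms(4) by simp
    qed
    moreover have "adjacent_match (replicate m 1 @ [2]) ?w (j - m)" if "m \<le> j"
      using that assms
      by (subst adjacent_match_level_ascent) (auto simp: nth_append hd_conv_nth)
    moreover have "0 < length v" using assms(3) by simp
    ultimately have "(i < j \<and> j < i + Suc m \<and> i + Suc m \<le> j + length v \<and>
        adjacent_match (replicate m 1 @ [2]) ?w i) \<longleftrightarrow> i + m = j" for i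
      using assms(1) by (intro iffI) (blast, clarsimp simp: Suc_le_eq)
    then have "{i. i < j \<and> j < i + Suc m \<and> i + Suc m \<le> j + length v \<and>
        adjacent_match (replicate m 1 @ [2]) ?w i} = {i. i + m = j}"
      by blast
    also have "\<dots> = (if m \<le> j then {j - m} else {})" by auto
    finally show ?thesis .
  qed
  moreover have "length (replicate m (1::nat) @ [2]) = Suc m" by simp
  ultimately show ?thesis
    using occurrences_append[OF sorted_patterns(2), of m "replicate j c" v]
    by (simp add: occurrences_level_ascent_replicate[OF assms(1)] del: One_nat_def)
qed

section \<open>Generating functions of sets of words\<close>

definition conc :: "'a list set \<Rightarrow> 'a list set \<Rightarrow> 'a list set" where
  "conc A B = (\<lambda>(u, v). u @ v) ` (A \<times> B)"

text \<open>A sum over an infinite set is 0 by convention, so the rules for unions and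
  concatenations assume finitely many words of each length.\<close>

definition word_gf :: "('a list \<Rightarrow> 'b::comm_ring_1) \<Rightarrow> 'a list set \<Rightarrow> 'b fps" where
  "word_gf wt A = Abs_fps (\<lambda>n. \<Sum>w | w \<in> A \<and> length w = n. wt w)"

lemma word_gf_nth: "word_gf wt A $ n = (\<Sum>w | w \<in> A \<and> length w = n. wt w)"
  by (simp add: word_gf_def)

lemma word_gf_Un:
  assumes "\<And>n. finite {w. w \<in> A \<and> length w = n}" "\<And>n. finite {w. w \<in> B \<and> length w = n}" "A \<inter> B = {}"
  shows "word_gf wt (A \<union> B) = word_gf wt A + word_gf wt B"
proof (rule fps_ext)
  fix n
  have "{w. w \<in> A \<union> B \<and> length w = n} = {w. w \<in> A \<and> length w = n} \<union> {w. w \<in> B \<and> length w = n}" by auto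
  then show "word_gf wt (A \<union> B) $ n = (word_gf wt A + word_gf wt B) $ n"
    using assms by (simp add: word_gf_nth) (rule sum.union_disjoint, auto)
qed

lemma word_gf_Nil: "word_gf wt {[] :: 'a list} = fps_const (wt [])"
proof (rule fps_ext)
  fix n :: nat
  have "{w::'a list. w \<in> {[]} \<and> length w = n} = (if n = 0 then {[]} else {})" by auto
  then show "word_gf wt {[]::'a list} $ n = fps_const (wt []) $ n" by (simp add: word_gf_nth)
qed

lemma conc_length_eq:
  "{w. w \<in> conc A B \<and> length w = n} =
   (\<lambda>(u, v). u @ v) ` (\<Union>i\<in>{0..n}. {u. u \<in> A \<and> length u = i} \<times> {v. v \<in> B \<and> length v = n - i})"
  by (force simp: conc_def)

lemma finite_conc:
  assumes "\<And>n. finite {w. w \<in> A \<and> length w = n}" "\<And>n. finite {w. w \<in> B \<and> length w = n}"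
  shows "finite {w. w \<in> conc A B \<and> length w = n}"
  unfolding conc_length_eq using assms by (intro finite_imageI finite_UN_I finite_cartesian_product) auto

text \<open>Injectivity says that factorizations are unique. Separate weights for the factors let a
  run of ones count differently when a larger letter follows than when it stands alone.\<close>

lemma word_gf_conc:
  assumes finA: "\<And>n. finite {w. w \<in> A \<and> length w = n}" and finB: "\<And>n. finite {w. w \<in> B \<and> length w = n}"
    and inj: "inj_on (\<lambda>(u, v). u @ v) (A \<times> B)"
    and wt: "\<And>u v. u \<in> A \<Longrightarrow> v \<in> B \<Longrightarrow> wt (u @ v) = wa u * wb v"
  shows "word_gf wt (conc A B) = word_gf wa A * word_gf wb B"
proof (rule fps_ext)
  fix n
  let ?A = "\<lambda>i. {u. u \<in> A \<and> length u = i}" and ?B = "\<lambda>i. {v. v \<in> B \<and> length v = i}"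
  have "word_gf wt (conc A B) $ n = (\<Sum>(u, v)\<in>(\<Union>i\<in>{0..n}. ?A i \<times> ?B (n - i)). wt (u @ v))"
    unfolding word_gf_nth conc_length_eq
    by (subst sum.reindex[OF inj_on_subset[OF inj]]) (auto simp: case_prod_unfold)
  also have "\<dots> = (\<Sum>i=0..n. \<Sum>(u, v)\<in>?A i \<times> ?B (n - i). wt (u @ v))"
    by (rule sum.UNION_disjoint) (use finA finB in auto)
  also have "\<dots> = (\<Sum>i=0..n. \<Sum>(u, v)\<in>?A i \<times> ?B (n - i). wa u * wb v)"
    by (intro sum.cong refl) (auto simp: wt)
  also have "\<dots> = (\<Sum>i=0..n. word_gf wa A $ i * word_gf wb B $ (n - i))"
    by (simp add: word_gf_nth sum_product sum.cartesian_product)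
  finally show "word_gf wt (conc A B) $ n = (word_gf wa A * word_gf wb B) $ n"
    by (simp add: fps_mult_nth)
qed

text \<open>The left factor is recovered as the longest prefix whose letters satisfy
  \<open>P\<close>.\<close>

lemma inj_on_append_takeWhile:
  assumes "\<And>u x. u \<in> A \<Longrightarrow> x \<in> set u \<Longrightarrow> P x" "\<And>v. v \<in> B \<Longrightarrow> v = [] \<or> \<not> P (hd v)"
  shows "inj_on (\<lambda>(u, v). u @ v) (A \<times> B)"
proof -
  have "takeWhile P (u @ v) = u" if "u \<in> A" "v \<in> B" for u v
    using that assms(1)[of u] assms(2)[of v] by (cases v) (auto simp: takeWhile_append)
  then show ?thesis by (intro inj_onI) (clarsimp, metis same_append_eq)
qed

section \<open>First-run decomposition of height words\<close>

definition runs :: "nat list set" where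
  "runs = {replicate j 1 | j. 1 \<le> j}"

definition lifted_words :: "nat list set" where
  "lifted_words = map Suc ` (height_words - {[]})"

lemma height_words_Nil: "[] \<in> height_words"
  by (simp add: height_words_def)

lemma height_words_hd: "w \<in> height_words \<Longrightarrow> w = [] \<or> hd w = 1"
  by (cases w) (auto simp: height_words_def)

lemma lifted_wordsD:
  assumes "w \<in> lifted_words"
  shows "w \<noteq> []" "x \<in> set w \<Longrightarrow> 1 < x" "hd w = 2"
proof -
  obtain v where v: "w = map Suc v" "v \<in> height_words" "v \<noteq> []" using assms by (auto simp: lifted_words_def)
  show "w \<noteq> []" using v by simp
  show "hd w = 2" using v height_words_hd[OF v(2)] by (simp add: hd_map)
  have "0 < y" if "y \<in> set u" "u \<in> height_words" for u y
    using that
  proof (induction u rule: rev_induct)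
    case (snoc x u)
    then show ?case by (auto simp: height_words_snoc)
  qed simp
  then show "1 < x" if "x \<in> set w" using v that by auto
qed

lemma height_words_append:
  "u @ v \<in> height_words \<longleftrightarrow> u \<in> height_words \<and> successively height_step (last (0 # u) # v)"
proof -
  have "successively height_step (a # u @ v) \<longleftrightarrow>
     successively height_step (a # u) \<and> successively height_step (last (a # u) # v)" for a
    by (induction u arbitrary: a) auto
  then show ?thesis by (simp add: height_words_def)
qed

lemma successively_height_step_map_Suc:
  assumes "\<forall>x\<in>set u. 0 < x"
  shows "successively height_step (Suc a # map Suc u) \<longleftrightarrow> successively height_step (a # u)"
  using assms by (induction u arbitrary: a) auto

lemma replicate_height_words: "replicate j 1 \<in> height_words"
proof -
  have "successively height_step (1 # replicate j 1)" by (induction j) auto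
  then show ?thesis by (cases j) (auto simp: height_words_def)
qed

text \<open>Cut a nonempty word after its initial ones and again before the next 1. The middle piece
  stays above 1 and starts from height 1, so lowering its letters by one gives a height word. The
  remainder is empty or begins with 1, which may follow any letter.\<close>

lemma height_words_decomposition:
  "height_words = {[]} \<union> (runs \<union> conc runs (conc lifted_words height_words))"
proof (intro equalityI subsetI)
  fix w assume w: "w \<in> height_words"
  define u r where "u = takeWhile (\<lambda>x. x = 1) w" and "r = dropWhile (\<lambda>x. x = 1) w"
  have wur: "w = u @ r" by (simp add: u_def r_def)
  have u: "u = replicate (length u) 1"
    by (rule replicate_eqI) (auto simp: u_def dest: set_takeWhileD)
  show "w \<in> {[]} \<union> (runs \<union> conc runs (conc lifted_words height_words))"
  proof (cases "w = []")
    case False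
    then have "u \<noteq> []" using height_words_hd[OF w] by (cases w) (auto simp: u_def)
    then have ur: "u \<in> runs" using u by (auto simp: runs_def Suc_le_eq intro!: exI[of _ "length u"])
    show ?thesis
    proof (cases "r = []")
      case True
      then show ?thesis using ur wur by simp
    next
      case False
      define a b where "a = takeWhile (\<lambda>x. x \<noteq> 1) r" and "b = dropWhile (\<lambda>x. x \<noteq> 1) r"
      have rab: "r = a @ b" by (simp add: a_def b_def)
      have "hd r \<noteq> 1" using hd_dropWhile[of "\<lambda>x. x = 1" w] False by (simp add: r_def)
      then have "a \<noteq> []" using False by (cases r) (auto simp: a_def)
      have "last (0 # u) = 1" using \<open>u \<noteq> []\<close> u by (metis last_ConsR last_replicate length_0_conv)
      then have "successively height_step (1 # a @ b)"
        using w height_words_append[of u r] by (simp add: wur rab)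
      then have ab: "successively height_step (1 # a)" "successively height_step b"
        using successively_append_iff[of height_step "1 # a" b] by auto
      define a' where "a' = map (\<lambda>x. x - 1) a"
      have pos: "0 < x" if "x \<in> set w" for x
      proof -
        \<comment> \<open>Letters of lifted words exceed 1, which gives positivity of the letters of
          \<open>w\<close>.\<close>
        have "map Suc w \<in> lifted_words" using w that by (auto simp: lifted_words_def)
        then show ?thesis using lifted_wordsD(2)[of "map Suc w" "Suc x"] that by simp
      qed
      have "1 < x" if "x \<in> set a" for x
      proof -
        have "x \<noteq> 1" using that set_takeWhileD[of x "\<lambda>x. x \<noteq> 1" r] by (auto simp: a_def)
        moreover have "0 < x" using that pos wur rab by simp
        ultimately show ?thesis by simp
      qed
      then have a': "a = map Suc a'" unfolding a'_def by (induction a) force+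
      have "a' \<in> height_words"
      proof -
        have "\<forall>x\<in>set a'. 0 < x" using \<open>\<And>x. x \<in> set a \<Longrightarrow> 1 < x\<close> by (auto simp: a')
        then show ?thesis
          using ab(1) successively_height_step_map_Suc[of a' 0] by (simp add: a' height_words_def)
      qed
      then have "a \<in> lifted_words" using \<open>a \<noteq> []\<close> by (auto simp: a' lifted_words_def)
      moreover have "b \<in> height_words"
      proof (cases b)
        case (Cons y ys)
        then have "y = 1" using hd_dropWhile[of "\<lambda>x. x \<noteq> 1" r] by (auto simp: b_def)
        then show ?thesis using ab(2) Cons by (simp add: height_words_def)
      qed (simp add: height_words_Nil)
      ultimately have "r \<in> conc lifted_words height_words" by (auto simp: conc_def rab)
      then show ?thesis using ur wur by (auto simp: conc_def)
    qed
  qed simp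
next
  fix w assume "w \<in> {[]} \<union> (runs \<union> conc runs (conc lifted_words height_words))"
  then consider "w = []" | "w \<in> runs" | "w \<in> conc runs (conc lifted_words height_words)" by blast
  then show "w \<in> height_words"
  proof cases
    case 3
    then obtain j a b where w: "w = replicate j 1 @ map Suc a @ b" "1 \<le> j" "a \<in> height_words" "a \<noteq> []" "b \<in> height_words"
      by (force simp: conc_def runs_def lifted_words_def)
    have pos: "\<forall>x\<in>set a. 0 < x"
    proof
      fix x assume "x \<in> set a"
      then show "0 < x" using lifted_wordsD(2)[of "map Suc a" "Suc x"] w by (auto simp: lifted_words_def)
    qed
    have l: "last (0 # replicate j 1) = (1::nat)" using w by simp
    have "successively height_step (1 # map Suc a)"
      using w pos successively_height_step_map_Suc[of a 0] by (simp add: height_words_def)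
    \<comment> \<open>A step down to 1 is allowed from every height, so the last letter of the
      middle piece is irrelevant.\<close>
    moreover have "successively height_step (c # b)" for c
      using w(5) by (cases b) (auto simp: height_words_def)
    ultimately show ?thesis unfolding w(1)
      by (simp only: append_assoc[symmetric] height_words_append[of _ b] height_words_append[of _ "map Suc a"] l
          replicate_height_words simp_thms)
  qed (use replicate_height_words height_words_Nil in \<open>auto simp: runs_def\<close>)
qed

section \<open>The functional equation\<close>

lemma finite_height_words: "finite {w. w \<in> height_words \<and> length w = n}"
proof -
  \<comment> \<open>Finiteness is inherited from set partitions along the two bijections.\<close>
  have "NC n \<subseteq> Pow (Pow {1..n})" by (auto simp: NC_def partition_on_def)
  then have "finite (NC n)" by (rule finite_subset) simp
  then show ?thesis
    using bij_betw_finite[OF bij_betw_canonical_form] bij_betw_finite[OF bij_betw_height_word, of n] by simp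
qed

lemma lifted_words_length_eq:
  "{w. w \<in> lifted_words \<and> length w = n} = map Suc ` {w. w \<in> height_words - {[]} \<and> length w = n}"
  by (auto simp: lifted_words_def)

lemma finite_lifted_words: "finite {w. w \<in> lifted_words \<and> length w = n}"
  unfolding lifted_words_length_eq by (rule finite_imageI, rule finite_subset[OF _ finite_height_words[of n]]) auto

lemma runs_length_eq: "{w. w \<in> runs \<and> length w = n} = (if n = 0 then {} else {replicate n 1})"
  by (auto simp: runs_def)

lemma word_gf_runs: "word_gf wt runs = Abs_fps (\<lambda>j. if j = 0 then 0 else wt (replicate j 1))"
  by (rule fps_ext) (simp add: word_gf_nth runs_length_eq)

lemma NC_gf_eq_word_gf:
  assumes "sorted \<tau>"
  shows "NC_gf \<tau> = word_gf (\<lambda>w. q_var ^ occurrences \<tau> w) height_words"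
proof (rule fps_ext)
  fix n
  have "(\<Sum>P\<in>NC n. q_var ^ occurrences \<tau> (canonical_form n P)) = (\<Sum>w\<in>NC_words n. q_var ^ occurrences \<tau> w)"
    by (rule sum.reindex_bij_betw[OF bij_betw_canonical_form])
  also have "\<dots> = (\<Sum>w\<in>NC_words n. q_var ^ occurrences \<tau> (height_word w))"
    by (intro sum.cong refl) (simp add: occurrences_height_word[OF assms])
  also have "\<dots> = (\<Sum>w | w \<in> height_words \<and> length w = n. q_var ^ occurrences \<tau> w)"
    by (rule sum.reindex_bij_betw[OF bij_betw_height_word])
  finally show "NC_gf \<tau> $ n = word_gf (\<lambda>w. q_var ^ occurrences \<tau> w) height_words $ n"
    by (simp add: NC_gf_def word_gf_nth)
qed

text \<open>The two series are \<open>K\<^sub>0\<close> and \<open>K\<^sub>1\<close>. The number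
  \<open>d j\<close> counts the occurrences that start in a run of \<open>j\<close> ones followed by
  a larger letter, including those that straddle the junction.\<close>

lemma NC_gf_equation:
  assumes \<tau>: "sorted \<tau>" "\<tau> \<noteq> []"
    and d: "\<And>j v. 1 \<le> j \<Longrightarrow> v \<noteq> [] \<Longrightarrow> 1 < hd v \<Longrightarrow> occurrences \<tau> (replicate j 1 @ v) = d j + occurrences \<tau> v"
  shows "NC_gf \<tau> = 1 + Abs_fps (\<lambda>j. if j = 0 then 0 else q_var ^ occurrences \<tau> (replicate j 1))
     + Abs_fps (\<lambda>j. if j = 0 then 0 else q_var ^ d j) * ((NC_gf \<tau> - 1) * NC_gf \<tau>)"
proof -
  define wt where "wt = (\<lambda>w. q_var ^ occurrences \<tau> w)"
  let ?F = "word_gf wt height_words" and ?NH = "conc lifted_words height_words"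
  have wt_Nil: "wt [] = 1" using \<tau>(2) by (simp add: wt_def occurrences_def)
  have NH: "v \<noteq> [] \<and> hd v = 2" if "v \<in> ?NH" for v
    using that lifted_wordsD by (fastforce simp: conc_def)
  have run: "u = replicate (length u) 1" "u \<noteq> []" if "u \<in> runs" for u
    using that by (auto simp: runs_def)
  have fin_runs: "finite {w. w \<in> runs \<and> length w = n}" for n by (simp add: runs_length_eq)
  note fin_NH = finite_conc[OF finite_lifted_words finite_height_words]
  note fin_RNH = finite_conc[OF fin_runs fin_NH]
  have "?F = word_gf wt {[]} + word_gf wt (height_words - {[]})"
  proof -
    have "finite {w. w \<in> height_words - {[]} \<and> length w = n}" for n
      by (rule finite_subset[OF _ finite_height_words[of n]]) auto
    then show ?thesis
      using word_gf_Un[of "{[]}" "height_words - {[]}" wt] height_words_Nil by (simp add: insert_absorb)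
  qed
  then have F1: "word_gf wt (height_words - {[]}) = ?F - 1" by (simp add: word_gf_Nil wt_Nil)
  have lifted: "word_gf wt lifted_words = ?F - 1"
  proof -
    have "word_gf wt lifted_words = word_gf wt (height_words - {[]})"
      by (rule fps_ext) (simp only: word_gf_nth lifted_words_length_eq, subst sum.reindex,
         auto intro: inj_on_subset[OF inj_mapI[OF inj_Suc]] simp: wt_def occurrences_map_Suc[OF \<tau>(1)])
    then show ?thesis using F1 by simp
  qed
  have NH_gf: "word_gf wt ?NH = (?F - 1) * ?F"
  proof (subst word_gf_conc[where wa = wt and wb = wt])
    show "inj_on (\<lambda>(u, v). u @ v) (lifted_words \<times> height_words)"
    proof (rule inj_on_append_takeWhile)
      show "x \<noteq> 1" if "u \<in> lifted_words" "x \<in> set u" for u x using lifted_wordsD(2)[OF that] by simp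
      show "v = [] \<or> \<not> hd v \<noteq> 1" if "v \<in> height_words" for v using height_words_hd[OF that] by simp
    qed
    show "wt (u @ v) = wt u * wt v" if u: "u \<in> lifted_words" and v: "v \<in> height_words" for u v
    proof -
      \<comment> \<open>Lifted letters exceed 1 and a nonempty height word begins with 1, so the
        junction is a descent.\<close>
      have "v = [] \<or> hd v < last u"
        using height_words_hd[OF v] lifted_wordsD(2)[OF u, of "last u"] lifted_wordsD(1)[OF u] by auto
      then show ?thesis
        using occurrences_append_descent[OF \<tau> lifted_wordsD(1)[OF u]] by (simp add: wt_def power_add)
    qed
  qed (simp_all add: lifted finite_height_words finite_lifted_words)
  have conc_gf: "word_gf wt (conc runs ?NH) = word_gf (\<lambda>u. q_var ^ d (length u)) runs * word_gf wt ?NH"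
  proof (rule word_gf_conc)
    show "inj_on (\<lambda>(u, v). u @ v) (runs \<times> ?NH)"
    proof (rule inj_on_append_takeWhile)
      show "x = 1" if "u \<in> runs" "x \<in> set u" for u x using that by (auto simp: runs_def)
      show "v = [] \<or> hd v \<noteq> 1" if "v \<in> ?NH" for v using NH[OF that] by simp
    qed
    show "wt (u @ v) = q_var ^ d (length u) * wt v" if "u \<in> runs" "v \<in> ?NH" for u v
      using that NH[OF that(2)] d[of _ v] by (auto simp: wt_def power_add runs_def simp del: One_nat_def)
  qed (use fin_runs fin_NH in auto)
  have F: "?F = word_gf wt {[]} + (word_gf wt runs + word_gf wt (conc runs ?NH))"
  proof -
    have "runs \<inter> conc runs ?NH = {}"
    proof (rule ccontr)
      assume "runs \<inter> conc runs ?NH \<noteq> {}"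
      then obtain u v where "u @ v \<in> runs" "v \<in> ?NH" by (auto simp: conc_def)
      \<comment> \<open>The word \<open>v\<close> contains a 2, while a run consists of
        ones.\<close>
      then show False using NH[of v] run(1)[of "u @ v"] hd_in_set[of v]
        by (metis One_nat_def Un_iff in_set_replicate numeral_eq_one_iff set_append semiring_norm(85) )
    qed
    moreover have "[] \<notin> runs" "[] \<notin> conc runs ?NH" using run(2) by (auto simp: conc_def)
    moreover have "finite {w. w \<in> runs \<union> conc runs ?NH \<and> length w = n}" for n
    proof (rule finite_subset)
      show "finite ({w. w \<in> runs \<and> length w = n} \<union> {w. w \<in> conc runs ?NH \<and> length w = n})"
        using fin_runs fin_RNH by blast
    qed blast
    ultimately show ?thesis
      using word_gf_Un[of runs "conc runs ?NH" wt] word_gf_Un[of "{[]}" "runs \<union> conc runs ?NH" wt]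
        fin_runs fin_RNH height_words_decomposition by simp
  qed
  have d_gf: "word_gf (\<lambda>u. q_var ^ d (length u)) runs = Abs_fps (\<lambda>j. if j = 0 then 0 else q_var ^ d j)"
    by (simp add: word_gf_runs cong: if_cong)
  have runs_gf: "word_gf wt runs = Abs_fps (\<lambda>j. if j = 0 then 0 else q_var ^ occurrences \<tau> (replicate j 1))"
    by (simp add: word_gf_runs wt_def)
  have NC: "NC_gf \<tau> = ?F" using NC_gf_eq_word_gf[OF \<tau>(1)] by (simp add: wt_def)
  show ?thesis unfolding NC
    by (subst F) (simp only: word_gf_Nil wt_Nil fps_const_1_eq_1 NH_gf conc_gf d_gf runs_gf add.assoc)
qed

section \<open>Solving the functional equations\<close>

text \<open>Completing the square gives \<open>(A - 2 * D * F) ^ 2 = S\<close>. Since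
  \<open>D\<close> has constant term 0 and \<open>A\<close> has constant term 1,
  \<open>A - 2 * D * F\<close> is the square root with constant term 1. The quotient is taken among
  Laurent series because \<open>E\<close> has constant term 0 and is no unit of the power series
  ring.\<close>

lemma quadratic_solution:
  fixes F D A C S :: "'a::field_char_0 fps"
  assumes "D * F ^ 2 = A * F - C" and S: "S = A ^ 2 - 4 * D * C"
    and "A $ 0 = 1" "D $ 0 = 0" "D \<noteq> 0" and E: "E = 2 * D"
  shows "fps_to_fls F = fps_to_fls (A - fps_sqrt S) / fps_to_fls E"
proof -
  have "(A - 2 * D * F) ^ 2 = A ^ 2 - 4 * D * (A * F - D * F ^ 2)"
    by (simp add: power2_eq_square algebra_simps)
  also have "\<dots> = S" using assms(1) S by simp
  finally have "(A - 2 * D * F) ^ 2 = S" .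
  moreover have "(A - 2 * D * F) $ 0 = 1" using assms by simp
  moreover have "S $ 0 = 1" using assms by (simp add: power2_eq_square)
  ultimately have "A - 2 * D * F = fps_sqrt S" by (subst fps_sqrt_unique) simp_all
  then have "F * E = A - fps_sqrt S" unfolding E by (simp add: algebra_simps)
  moreover have "fps_to_fls E \<noteq> 0" using assms by simp
  ultimately show ?thesis by (simp add: nonzero_eq_divide_eq flip: fls_times_fps_to_fls)
qed

text \<open>Multiplication by \<open>1 - fps_X\<close> takes differences of consecutive
  coefficients. These vanish for \<open>0 < n < m\<close> and are
  \<open>(c - 1) * c ^ (n - m)\<close> from \<open>m\<close> on, a geometric series that the other
  factor clears.\<close>

lemma run_gf_level:
  fixes c :: "'a::comm_ring_1"
  assumes "m \<ge> 1"
  shows "(1 - fps_const c * fps_X) * (1 - fps_X) * (1 + Abs_fps (\<lambda>j. if j = 0 then 0 else c ^ (Suc j - m)))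
     = 1 - fps_const c * fps_X + (fps_const c - 1) * fps_X ^ m"
proof -
  define T G where "T = 1 + Abs_fps (\<lambda>j. if j = 0 then 0 else c ^ (Suc j - m))" and "G = Abs_fps (\<lambda>j. c ^ j)"
  have G: "(1 - fps_const c * fps_X) * G = 1"
  proof (rule fps_ext)
    show "((1 - fps_const c * fps_X) * G) $ n = 1 $ n" for n
      by (cases n) (simp_all add: G_def left_diff_distrib mult.assoc)
  qed
  \<comment> \<open>At \<open>j = 0\<close> the exponent is 0 because \<open>m \<ge> 1\<close>,
    which agrees with the added 1.\<close>
  have T: "T $ j = c ^ (Suc j - m)" for j using assms by (simp add: T_def)
  have "(1 - fps_X) * T = 1 + (fps_const c - 1) * fps_X ^ m * G"
  proof (rule fps_ext)
    fix n
    have "((1 - fps_X) * T) $ n = T $ n - (if n = 0 then 0 else T $ (n - 1))"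
      by (simp add: left_diff_distrib)
    moreover have "(1 + (fps_const c - 1) * fps_X ^ m * G) $ n =
        (if n = 0 then 1 else 0) + (if n < m then 0 else (c - 1) * c ^ (n - m))"
      by (simp add: G_def mult.assoc left_diff_distrib fps_X_power_mult_nth)
    ultimately show "((1 - fps_X) * T) $ n = (1 + (fps_const c - 1) * fps_X ^ m * G) $ n"
      using assms by (cases n) (auto simp: T algebra_simps Suc_diff_le)
  qed
  then have "(1 - fps_const c * fps_X) * ((1 - fps_X) * T) =
      (1 - fps_const c * fps_X) * (1 + (fps_const c - 1) * fps_X ^ m * G)"
    by (rule arg_cong)
  also have "\<dots> = 1 - fps_const c * fps_X + (fps_const c - 1) * fps_X ^ m * ((1 - fps_const c * fps_X) * G)"
    by (simp add: algebra_simps)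
  finally have "(1 - fps_const c * fps_X) * ((1 - fps_X) * T) = \<dots>" .
  then show ?thesis by (simp add: G T_def[symmetric] mult.assoc)
qed

text \<open>The coefficients jump by 1 at \<open>n = 1\<close> and by \<open>c - 1\<close> at
  \<open>n = m\<close>; for \<open>m = 1\<close> both jumps fall together.\<close>

lemma run_gf_level_ascent:
  fixes c :: "'a::comm_ring_1"
  assumes "m \<ge> 1"
  shows "(1 - fps_X) * Abs_fps (\<lambda>j. if j = 0 then 0 else c ^ of_bool (m \<le> j))
     = fps_X + (fps_const c - 1) * fps_X ^ m" (is "(1 - fps_X) * ?K = _")
proof (rule fps_ext)
  fix n
  have "((1 - fps_X) * ?K) $ n = ?K $ n - (if n = 0 then 0 else ?K $ (n - 1))"
    by (simp add: left_diff_distrib)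
  moreover have "(fps_X + (fps_const c - 1) * fps_X ^ m) $ n = of_bool (n = 1) + (c - 1) * of_bool (n = m)"
    by (simp add: left_diff_distrib)
  ultimately show "((1 - fps_X) * ?K) $ n = (fps_X + (fps_const c - 1) * fps_X ^ m) $ n"
    using assms by (cases n) (auto simp: Suc_le_eq)
qed

theorem corollary2:
  fixes m :: nat and q x :: "rat poly fract fps"
  assumes "m \<ge> 1"
  defines "q \<equiv> fps_const q_var" and "x \<equiv> fps_X"
  shows "fps_to_fls (NC_gf (replicate m 1)) =
           fps_to_fls (1 - q * x + (q - 1) * x ^ m
             - fps_sqrt ((1 - q * x + (q - 1) * x ^ m)
                 * ((1 - 4 * x) * (1 - q * x) - 3 * (q - 1) * x ^ m)))
           / fps_to_fls (2 * x * (1 - q * x + (q - 1) * x ^ (m - 1)))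
         \<and> fps_to_fls (NC_gf (replicate m 1 @ [2])) =
           fps_to_fls (1 + (q - 1) * x ^ m
             - fps_sqrt ((1 - (q - 1) * x ^ m) ^ 2 - 4 * x))
           / fps_to_fls (2 * x * (1 + (q - 1) * x ^ (m - 1)))"
proof
  define u where "u = (q - 1) * x ^ m"
  have xm: "x * x ^ (m - 1) = x ^ m" using assms(1) by (metis Suc_diff_1 Suc_le_eq One_nat_def power_Suc)
  have u0: "u $ 0 = 0" using assms(1) by (simp add: u_def x_def)
  \<comment> \<open>Both quadratics have a leading coefficient whose coefficient at \<open>x\<close>
    is \<open>1 + u $ 1\<close>. For \<open>m = 1\<close> this equals \<open>q_var\<close>,
    otherwise 1, so neither leading coefficient is zero.\<close>
  have "q_var \<noteq> 0" by (simp add: q_var_def)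
  moreover have "u $ 1 = (if m = 1 then q_var - 1 else 0)"
    by (simp add: u_def x_def q_def left_diff_distrib)
  ultimately have u1: "u $ 1 \<noteq> -1" by auto
  have x01: "x $ 0 = 0" "x $ 1 = 1" by (simp_all add: x_def)

  let ?F = "NC_gf (replicate m 1)"
  define K where "K = Abs_fps (\<lambda>j. if j = 0 then 0 else q_var ^ (Suc j - m))"
  have "?F = 1 + K + K * ((?F - 1) * ?F)"
    unfolding K_def occurrences_level_replicate[OF assms(1), of _ 1, symmetric]
  proof (rule NC_gf_equation)
    show "occurrences (replicate m 1) (replicate j 1 @ v)
       = occurrences (replicate m 1) (replicate j 1) + occurrences (replicate m 1) v"
      if "1 \<le> j" "v \<noteq> []" "1 < hd v" for j v
      using that assms(1) by (intro occurrences_level_append_ascent) auto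
  qed (use assms(1) sorted_patterns in auto)
  then have "(1 - q * x) * (1 - x) * ?F = (1 - q * x) * (1 - x) * (1 + K + K * ((?F - 1) * ?F))"
    by simp
  \<comment> \<open>With \<open>Z = (?F - 1) * ?F\<close> this is
    \<open>1 + K + K * Z = (1 + K) * (1 + Z) - Z\<close>, so that \<open>K\<close> enters only
    through \<open>1 + K\<close>, whose denominator is known.\<close>
  also have "\<dots> = ((1 - q * x) * (1 - x) * (1 + K)) * (1 + (?F - 1) * ?F) - (1 - q * x) * (1 - x) * ((?F - 1) * ?F)"
    by (simp add: algebra_simps)
  also have "(1 - q * x) * (1 - x) * (1 + K) = 1 - q * x + u"
    using run_gf_level[OF assms(1), of q_var] by (simp add: K_def q_def x_def u_def)
  finally have quad: "(x * (1 - q * x) + u) * ?F ^ 2 = (1 - q * x + u) * ?F - (1 - q * x + u)"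
    by (simp add: algebra_simps power2_eq_square)
  have "(x * (1 - q * x) + u) $ 1 = 1 + u $ 1" by (simp add: x_def q_def right_diff_distrib)
  then have nz: "x * (1 - q * x) + u \<noteq> 0"
    using u1 by (metis add.inverse_unique fps_zero_nth)
  show "fps_to_fls ?F =
           fps_to_fls (1 - q * x + (q - 1) * x ^ m
             - fps_sqrt ((1 - q * x + (q - 1) * x ^ m)
                 * ((1 - 4 * x) * (1 - q * x) - 3 * (q - 1) * x ^ m)))
           / fps_to_fls (2 * x * (1 - q * x + (q - 1) * x ^ (m - 1)))"
    unfolding u_def[symmetric] mult.assoc[of 3]
  \<comment> \<open>Here \<open>A = C = 1 - q * x + u\<close>, which explains the common factor
    under the root.\<close>
  proof (rule quadratic_solution[OF quad _ _ _ nz])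
    show "2 * x * (1 - q * x + (q - 1) * x ^ (m - 1)) = 2 * (x * (1 - q * x) + u)"
      unfolding u_def xm[symmetric] by (simp add: algebra_simps)
  qed (simp_all add: u0 x01 algebra_simps power2_eq_square)

  let ?G = "NC_gf (replicate m 1 @ [2])"
  define L where "L = Abs_fps (\<lambda>j. if j = 0 then 0 else q_var ^ of_bool (m \<le> j))"
  define M where "M = Abs_fps (\<lambda>j. if j = 0 then 0 else q_var ^ 0)"
  have "?G = 1 + M + L * ((?G - 1) * ?G)"
  proof -
    have "?G = 1 + Abs_fps (\<lambda>j. if j = 0 then 0 else q_var ^ occurrences (replicate m 1 @ [2]) (replicate j 1))
        + L * ((?G - 1) * ?G)"
      unfolding L_def
      by (rule NC_gf_equation) (use sorted_patterns occurrences_level_ascent_run[OF assms(1)] in auto)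
    then show ?thesis unfolding occurrences_level_ascent_replicate[OF assms(1)] M_def .
  qed
  then have "(1 - x) * ?G = (1 - x) * (1 + M + L * ((?G - 1) * ?G))" by simp
  also have "\<dots> = (1 - x) + (1 - x) * M + ((1 - x) * L) * ((?G - 1) * ?G)"
    by (simp add: algebra_simps)
  also have "(1 - x) * M = x"
    \<comment> \<open>For \<open>c = 1\<close> all runs have weight 1 and the term with
      \<open>c - 1\<close> vanishes.\<close>
    using run_gf_level_ascent[of 1 "1::rat poly fract"] by (simp add: M_def x_def cong: if_cong)
  also have "(1 - x) * L = x + u"
    using run_gf_level_ascent[OF assms(1), of q_var] by (simp add: L_def q_def x_def u_def)
  finally have quad: "(x + u) * ?G ^ 2 = (1 + u) * ?G - 1"
    by (simp add: algebra_simps power2_eq_square)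
  have nz: "x + u \<noteq> 0"
    using u1 x01 by (metis add.inverse_unique fps_zero_nth fps_add_nth)
  show "fps_to_fls ?G =
           fps_to_fls (1 + (q - 1) * x ^ m
             - fps_sqrt ((1 - (q - 1) * x ^ m) ^ 2 - 4 * x))
           / fps_to_fls (2 * x * (1 + (q - 1) * x ^ (m - 1)))"
    unfolding u_def[symmetric]
  \<comment> \<open>The discriminant is
    \<open>(1 + u) ^ 2 - 4 * (x + u) = (1 - u) ^ 2 - 4 * x\<close>.\<close>
  proof (rule quadratic_solution[OF quad _ _ _ nz])
    show "2 * x * (1 + (q - 1) * x ^ (m - 1)) = 2 * (x + u)"
      unfolding u_def xm[symmetric] by (simp add: algebra_simps)
  qed (simp_all add: u0 x01 algebra_simps power2_eq_square)
qed

end
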